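(* Let $n\ge1$ be an integer, and assume $m\in[0,1]$ and $\frac{R\mu}{C}\ge n+1$. Let $(\rho_t,f_n(\rho_t))$ be the tangent point on the graph of $f_n$ of the line through $(m,f_n(m))$. Then the worst-case expected social benefit rate $Z_s(n)=\inf_{\mathbb P\in\mathcal P}\mathbb E_{\mathbb P}[f_n(\tilde\rho)]$ is given as follows: 1. If $f_n(b)+f_n'(b)(m-b)\ge f_n(m)$, then $$Z_s(n)=\frac{d}{2(m-a)}f_n(a)+\left(1-\frac{d}{2(m-a)}-\frac{d}{2(b-m)}\right)f_n(m)+\frac{d}{2(b-m)}f_n(b).$$ 2. If $f_n(b)+f_n'(b)(m-b)<f_n(m)$ and $d<d_0:=\frac{2(m-a)(\rho_t-m)}{\rho_t-a}$, then $$Z_s(n)=\frac{d}{2(m-a)}f_n(a)+\left(1-\frac{d}{2(m-a)}-\frac{d}{2(\rho_t-m)}\right)f_n(m)+\frac{d}{2(\rho_t-m)}f_n(\rho_t).$$ 3. If $f_n(b)+f_n'(b)(m-b)<f_n(m)$ and $d\ge d_0:=\frac{2(m-a)(\rho_t-m)}{\rho_t-a}$, then $$Z_s(n)=\frac{d}{2(m-a)}f_n(a)+\left(1-\frac{d}{2(m-a)}\right)f_n\!\left(\frac{ad+2m(a-m)}{d+2(a-m)}\right).$$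
   Context: $R,C,\mu>0$ are fixed real constants. For an integer $n\ge0$, $f_n:[0,\infty)\to\mathbb R$ is $$f_n(\rho)=R\mu\,\frac{\rho(1-\rho^n)}{1-\rho^{n+1}}-C\left(\frac{\rho}{1-\rho}-\frac{(n+1)\rho^{n+1}}{1-\rho^{n+1}}\right)\ (\rho\ne1),\qquad f_n(1)=R\mu\,\frac{n}{n+1}-C\,\frac n2 .$$ Real numbers $0\le a<b$, $m\in(a,b)$ and $d\in(0,\overline d)$ with $\overline d=\frac{2(m-a)(b-m)}{b-a}$ are given. The mean-absolute-deviation (MAD) ambiguity set is $$\mathcal P=\{\mathbb P \text{ a Borel probability measure on }[a,b]:\ \mathbb E_{\mathbb P}[\tilde\rho]=m,\ \mathbb E_{\mathbb P}[|\tilde\rho-m|]=d\}.$$ The tangent point (used only in cases 2 and 3) is the point with $\rho_t\in(m,b]$ and $f_n(\rho_t)+f_n'(\rho_t)(m-\rho_t)=f_n(m)$. *)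

theory Defs
  imports "HOL-Probability.Probability"
begin

text \<open>The function \<open>f\<^sub>n\<close>. It is used only for \<open>\<rho> \<ge> 0\<close>, where the denominators vanish only
  at \<open>\<rho> = 1\<close>; all points at which its derivative is taken below are positive.\<close>

definition benefit_rate :: "real \<Rightarrow> real \<Rightarrow> real \<Rightarrow> nat \<Rightarrow> real \<Rightarrow> real" where
  "benefit_rate R C \<mu> n \<rho> =
     (if \<rho> = 1 then R * \<mu> * (real n / (real n + 1)) - C * (real n / 2)
      else R * \<mu> * (\<rho> * (1 - \<rho> ^ n) / (1 - \<rho> ^ (n + 1)))
           - C * (\<rho> / (1 - \<rho>) - (real n + 1) * \<rho> ^ (n + 1) / (1 - \<rho> ^ (n + 1))))"

definition mad_ambiguity_set :: "real \<Rightarrow> real \<Rightarrow> real \<Rightarrow> real \<Rightarrow> real measure set" where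
  "mad_ambiguity_set a b m d =
     {P. prob_space P \<and> sets P = sets (restrict_space borel {a..b}) \<and>
         (\<integral>x. x \<partial>P) = m \<and> (\<integral>x. \<bar>x - m\<bar> \<partial>P) = d}"

definition worst_case_benefit ::
  "real \<Rightarrow> real \<Rightarrow> real \<Rightarrow> real \<Rightarrow> real \<Rightarrow> real \<Rightarrow> real \<Rightarrow> nat \<Rightarrow> real" where
  "worst_case_benefit R C \<mu> a b m d n =
     (INF P \<in> mad_ambiguity_set a b m d. \<integral>x. benefit_rate R C \<mu> n x \<partial>P)"

text \<open>The abscissa of the point of tangency, on \<open>(m, b]\<close>, of the line through \<open>(m, f m)\<close>.
  The definite description is meaningful only if there is exactly one such point; a fact
  about its value therefore depends on existence and uniqueness.\<close>

definition tangent_point :: "(real \<Rightarrow> real) \<Rightarrow> real \<Rightarrow> real \<Rightarrow> real" where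
  "tangent_point f m b = (THE \<rho>. \<rho> \<in> {m<..b} \<and> f \<rho> + deriv f \<rho> * (m - \<rho>) = f m)"

end

theory Submission
  imports Defs
begin

text \<open>The rate \<open>f\<^sub>n\<close> is strictly concave on \<open>[0, c]\<close> and strictly convex on \<open>[c, b]\<close> for some
  \<open>c > m\<close>. To see this, put \<open>\<rho> = exp (2 t)\<close>, \<open>N = n + 1\<close> and \<open>U t = sinh (N t) / sinh t\<close>. Up to a
  factor of known sign, \<open>f\<^sub>n''\<close> becomes \<open>E = H - l G\<close> with \<open>l > 0\<close>, \<open>H\<close> even, \<open>G\<close> odd and
  \<open>H 0 = G 0 = 0\<close>; here \<open>G'\<close> is a positive multiple of \<open>sinh (N t) sinh t\<close> and \<open>H'\<close> one of
  \<open>sinh (N t) (X t - X 0 cosh t)\<close>, where \<open>X = U U' / sinh\<close> is a nonnegative combination of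
  functions \<open>cosh (k t)\<close> with \<open>k\<close> odd. Since \<open>(cosh (k t) - cosh t) / sinh t\<close> increases for odd
  \<open>k\<close>, so does \<open>H' / G'\<close>. Hence \<open>E\<close> first decreases and then increases on \<open>t > 0\<close> and changes sign
  at most once there, while \<open>E > 0\<close> for \<open>t < 0\<close>.

  Given this shape, in each of the three cases \<open>f\<^sub>n\<close> has a minorant that is linear on \<open>[a, m]\<close> and
  on \<open>[m, b]\<close>. Its expectation is the same for every measure of the ambiguity set, and it touches
  \<open>f\<^sub>n\<close> on the support of a measure of this set with atoms in \<open>{a, m, x}\<close>, where \<open>x\<close> is \<open>b\<close>, the
  tangent point, or (case 3) the point that leaves no mass at \<open>m\<close>.\<close>

section \<open>Hyperbolic cosine sums\<close>

text \<open>The flag is the common parity of all frequencies, \<open>True\<close> for even.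
  Frequencies are integers of either sign, so that the difference \<open>k - l\<close> arising in
  products stays inside the predicate without a case distinction.\<close>

inductive cosh_sum :: "bool \<Rightarrow> (real \<Rightarrow> real) \<Rightarrow> bool" for p :: bool where
  zero: "cosh_sum p (\<lambda>t. 0)"
| add_cosh: "cosh_sum p X \<Longrightarrow> w \<ge> 0 \<Longrightarrow> even k = p
    \<Longrightarrow> cosh_sum p (\<lambda>t. X t + w * cosh (of_int k * t))"

lemma cosh_sum_single:
  assumes "w \<ge> 0" "even k = p"
  shows "cosh_sum p (\<lambda>t. w * cosh (of_int k * t))"
  using add_cosh[OF zero assms] by simp

lemma cosh_sum_add:
  assumes "cosh_sum p Y" "cosh_sum p X"
  shows "cosh_sum p (\<lambda>t. X t + Y t)"
  using assms
proof (induction)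
  case (add_cosh Y w k)
  have "cosh_sum p (\<lambda>t. (X t + Y t) + w * cosh (of_int k * t))"
    using add_cosh by (intro cosh_sum.add_cosh) auto
  then show ?case by (simp add: add.assoc)
qed simp

lemma cosh_sum_scale:
  assumes "cosh_sum p X" "c \<ge> 0"
  shows "cosh_sum p (\<lambda>t. c * X t)"
  using assms
proof (induction)
  case zero
  show ?case by (simp add: cosh_sum.zero)
next
  case (add_cosh X w k)
  have "cosh_sum p (\<lambda>t. c * X t + (c * w) * cosh (of_int k * t))"
    using add_cosh by (intro cosh_sum.add_cosh) auto
  then show ?case by (simp add: algebra_simps)
qed

text \<open>Product-to-sum: 2 cosh x cosh y = cosh (x + y) + cosh (x - y). The frequencies
  \<open>k + l\<close> and \<open>k - l\<close> are both even exactly when \<open>k\<close> and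
  \<open>l\<close> have the same parity.\<close>

lemma cosh_sum_mult_cosh:
  assumes "cosh_sum p X" "w \<ge> 0" "even k = q"
  shows "cosh_sum (p = q) (\<lambda>t. w * cosh (of_int k * t) * X t)"
  using assms
proof (induction)
  case zero
  show ?case by (simp add: cosh_sum.zero)
next
  case (add_cosh X v l)
  have "cosh_sum (p = q) (\<lambda>t. w * cosh (of_int k * t) * X t
      + (w * v / 2) * cosh (of_int (k + l) * t) + (w * v / 2) * cosh (of_int (k - l) * t))"
    using add_cosh by (intro cosh_sum.add_cosh) auto
  moreover have "w * cosh (of_int k * t) * X t
      + (w * v / 2) * cosh (of_int (k + l) * t) + (w * v / 2) * cosh (of_int (k - l) * t)
      = w * cosh (of_int k * t) * (X t + v * cosh (of_int l * t))" for t
    by (simp add: distrib_right left_diff_distrib cosh_add cosh_diff algebra_simps)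
  ultimately show ?case by (simp only:)
qed

lemma cosh_sum_mult:
  assumes "cosh_sum q Y" "cosh_sum p X"
  shows "cosh_sum (p = q) (\<lambda>t. Y t * X t)"
  using assms
proof (induction)
  case zero
  show ?case by (simp add: cosh_sum.zero)
next
  case (add_cosh Y w k)
  have "cosh_sum (p = q) (\<lambda>t. Y t * X t + w * cosh (of_int k * t) * X t)"
    using add_cosh by (intro cosh_sum_add cosh_sum_mult_cosh) auto
  then show ?case by (simp add: algebra_simps)
qed

lemma cosh_mono_abs:
  fixes s t :: real
  assumes "0 \<le> s" "s \<le> t"
  shows "cosh (k * s) \<le> cosh (k * t)"
proof -
  have "cosh (\<bar>k\<bar> * s) \<le> cosh (\<bar>k\<bar> * t)"
    using assms by (subst cosh_real_nonneg_le_iff) (auto intro: mult_left_mono)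
  then show ?thesis by (cases "k \<ge> 0") auto
qed

lemma cosh_sum_mono:
  assumes "cosh_sum p X"
  shows "mono_on {0..} X \<and> (\<forall>t. X t \<ge> 0) \<and> continuous_on UNIV X"
  using assms
proof (induction)
  case zero
  then show ?case by (auto simp: mono_on_def)
next
  case (add_cosh X w k)
  have "mono_on {0..} (\<lambda>t. X t + w * cosh (of_int k * t))"
    using add_cosh
    by (auto simp: mono_on_def intro!: add_mono mult_left_mono cosh_mono_abs)
  moreover have "continuous_on UNIV (\<lambda>t. X t + w * cosh (of_int k * t))"
    using add_cosh by (auto intro!: continuous_intros)
  moreover have "\<forall>t. X t + w * cosh (of_int k * t) \<ge> 0"
    using add_cosh by auto
  ultimately show ?case by blast
qed

text \<open>\<open>cheb_U N t = sinh (N t) / sinh t\<close>, with the value \<open>N\<close> at \<open>t = 0\<close>, and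
  \<open>cheb_V N t\<close> is its derivative divided by \<open>sinh t\<close>.\<close>

fun cheb_U :: "nat \<Rightarrow> real \<Rightarrow> real" where
  "cheb_U 0 t = 0"
| "cheb_U (Suc 0) t = 1"
| "cheb_U (Suc (Suc n)) t = cheb_U n t + 2 * cosh (real (Suc n) * t)"

fun cheb_V :: "nat \<Rightarrow> real \<Rightarrow> real" where
  "cheb_V 0 t = 0"
| "cheb_V (Suc 0) t = 0"
| "cheb_V (Suc (Suc n)) t = cheb_V n t + 2 * real (Suc n) * cheb_U (Suc n) t"

text \<open>The recursion is the identity sinh ((n + 2) t) - sinh (n t) = 2 cosh ((n + 1) t) sinh t
  divided by sinh t.\<close>

lemma cheb_U_sinh: "cheb_U n t * sinh t = sinh (real n * t)"
proof (induction n t rule: cheb_U.induct)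
  case (3 n t)
  have "real (Suc (Suc n)) * t = real (Suc n) * t + t" "real n * t = real (Suc n) * t - t"
    by (simp_all add: algebra_simps)
  then have "sinh (real (Suc (Suc n)) * t) = sinh (real n * t) + 2 * cosh (real (Suc n) * t) * sinh t"
    by (simp only: sinh_add sinh_diff)
  with 3 show ?case by (simp only: cheb_U.simps distrib_right)
qed simp_all

text \<open>The term added by the recursion has derivative 2 (n + 1) sinh ((n + 1) t), which
  \<open>cheb_U_sinh\<close> turns into a multiple of sinh t; this explains the recursion of
  \<open>cheb_V\<close>.\<close>

lemma has_derivative_cheb_U:
  "(cheb_U n has_real_derivative cheb_V n t * sinh t) (at t)"
proof (induction n t rule: cheb_U.induct)
  case (3 n t)
  have "((\<lambda>t. cheb_U n t + 2 * cosh (real (Suc n) * t)) has_real_derivative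
      cheb_V n t * sinh t + 2 * (sinh (real (Suc n) * t) * real (Suc n))) (at t)"
    by (auto intro!: derivative_eq_intros 3 simp del: of_nat_Suc)
  moreover have "cheb_V n t * sinh t + 2 * (sinh (real (Suc n) * t) * real (Suc n))
      = cheb_V (Suc (Suc n)) t * sinh t"
    unfolding cheb_V.simps cheb_U_sinh[of "Suc n" t, symmetric]
    by (simp del: cheb_U.simps of_nat_Suc add: distrib_right)
  moreover have "cheb_U (Suc (Suc n)) = (\<lambda>t. cheb_U n t + 2 * cosh (real (Suc n) * t))"
    by (rule ext) (simp only: cheb_U.simps)
  ultimately show ?case by simp
qed (simp_all add: cheb_U.simps(1,2)[abs_def])

lemma cheb_U_0: "cheb_U n 0 = real n"
  by (induction n "0::real" rule: cheb_U.induct) auto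

lemma cheb_V_0: "cheb_V n 0 = real n * ((real n)\<^sup>2 - 1) / 3"
  by (induction n "0::real" rule: cheb_V.induct)
    (auto simp: cheb_U_0 field_simps power2_eq_square)

lemma cosh_sum_cheb_U: "cosh_sum (odd n) (cheb_U n)"
proof (induction n rule: induct_nat_012)
  case 0
  have "cheb_U 0 = (\<lambda>t. 0)" by auto
  then show ?case by (simp add: cosh_sum.zero)
next
  case 1
  have "cheb_U (Suc 0) = (\<lambda>t. 1 * cosh (of_int 0 * t))" by auto
  moreover have "cosh_sum (odd (Suc 0)) (\<lambda>t. 1 * cosh (of_int 0 * t))"
    by (rule cosh_sum_single) auto
  ultimately show ?case by metis
next
  case (ge2 n)
  have "cosh_sum (odd n) (\<lambda>t. cheb_U n t + 2 * cosh (of_int (int (Suc n)) * t))"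
    using ge2 by (intro cosh_sum.add_cosh) auto
  moreover have "cheb_U (Suc (Suc n)) = (\<lambda>t. cheb_U n t + 2 * cosh (of_int (int (Suc n)) * t))"
    by auto
  ultimately show ?case by (simp del: of_nat_Suc)
qed

text \<open>The frequencies of \<open>cheb_U n\<close> have the parity of n - 1 and those of
  \<open>cheb_V n\<close> the parity of n, so the product of the two has odd frequencies only,
  whatever n is.\<close>

lemma cosh_sum_cheb_V: "cosh_sum (even n) (cheb_V n)"
proof (induction n rule: induct_nat_012)
  case 0
  have "cheb_V 0 = (\<lambda>t. 0)" by auto
  then show ?case by (simp add: cosh_sum.zero)
next
  case 1
  have "cheb_V (Suc 0) = (\<lambda>t. 0)" by auto
  then show ?case by (simp add: cosh_sum.zero)
next
  case (ge2 n)
  have "cosh_sum (even n) (\<lambda>t. cheb_V n t + 2 * real (Suc n) * cheb_U (Suc n) t)"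
    using ge2 cosh_sum_cheb_U[of "Suc n"] by (intro cosh_sum_add cosh_sum_scale) auto
  moreover have "cheb_V (Suc (Suc n)) = (\<lambda>t. cheb_V n t + 2 * real (Suc n) * cheb_U (Suc n) t)"
    by (rule ext) (rule cheb_V.simps)
  ultimately show ?case by (simp del: of_nat_Suc)
qed

text \<open>The quotients below vanish identically when \<open>n = 1\<close>, hence the first disjunct.\<close>

definition rising :: "(real \<Rightarrow> real) \<Rightarrow> bool" where
  "rising \<psi> \<longleftrightarrow> continuous_on UNIV \<psi> \<and> \<psi> 0 = 0 \<and> ((\<forall>t. \<psi> t = 0) \<or> strict_mono_on {0..} \<psi>)"

section \<open>Increasing quotients by sinh t\<close>

lemma rising_add:
  assumes "rising \<psi>" "rising \<phi>"
  shows "rising (\<lambda>t. \<psi> t + \<phi> t)"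
proof -
  have "(\<forall>t. \<psi> t + \<phi> t = 0) \<or> strict_mono_on {0..} (\<lambda>t. \<psi> t + \<phi> t)"
    using assms unfolding rising_def strict_mono_on_def
    by (smt (verit))
  then show ?thesis using assms unfolding rising_def by (auto intro!: continuous_intros)
qed

lemma rising_scale:
  assumes "rising \<psi>" "w \<ge> 0"
  shows "rising (\<lambda>t. w * \<psi> t)"
  using assms unfolding rising_def
  by (cases "w = 0") (auto intro!: continuous_intros simp: strict_mono_on_def)

text \<open>For \<open>k = 2 * p + 1\<close> the difference is 2 sinh ((p + 1) t) sinh (p t), and
  sinh (p t) is \<open>cheb_U p t * sinh t\<close>. The quotient 2 sinh ((p + 1) t)
  \<open>cheb_U p t\<close> is a product of nonnegative increasing factors on t >= 0; it is zero for
  p = 0.\<close>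

lemma cosh_odd_quotient:
  assumes "odd (k::int)"
  shows "\<exists>\<psi>. rising \<psi> \<and> (\<forall>t. cosh (of_int k * t) - cosh t = sinh t * \<psi> t)"
proof -
  have nonneg: "\<exists>\<psi>. rising \<psi> \<and> (\<forall>t. cosh (real (2 * p + 1) * t) - cosh t = sinh t * \<psi> t)" for p
  proof (intro exI conjI allI)
    let ?\<psi> = "\<lambda>t. 2 * sinh (real (Suc p) * t) * cheb_U p t"
    have cs: "mono_on {0..} (cheb_U p)" "continuous_on UNIV (cheb_U p)" "\<And>t. cheb_U p t \<ge> 0"
      using cosh_sum_mono[OF cosh_sum_cheb_U[of p]] by auto
    have "strict_mono_on {0..} ?\<psi>" if "p > 0"
    proof (rule strict_mono_onI)
      fix s t :: real assume st: "s \<in> {0..}" "t \<in> {0..}" "s < t"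
      have "sinh (real (Suc p) * s) < sinh (real (Suc p) * t)"
        using st by simp
      moreover have "cheb_U p s \<le> cheb_U p t" using cs(1) st by (auto simp: mono_on_def)
      moreover have "cheb_U p 0 \<le> cheb_U p t" using cs(1) st by (auto simp: mono_on_def)
      then have "cheb_U p t > 0" using that by (simp add: cheb_U_0)
      moreover have "sinh (real (Suc p) * s) \<ge> 0" using st by simp
      ultimately have "sinh (real (Suc p) * s) * cheb_U p s < sinh (real (Suc p) * t) * cheb_U p t"
        by (metis mult_le_less_imp_less mult_left_mono mult_strict_right_mono order_le_less_trans)
      then show "?\<psi> s < ?\<psi> t" by simp
    qed
    then show "rising ?\<psi>" using cs unfolding rising_def
      by (cases "p = 0") (auto intro!: continuous_intros)
    fix t
    have "real (2 * p + 1) * t = real (Suc p) * t + real p * t" "t = real (Suc p) * t - real p * t"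
      by (simp_all add: algebra_simps)
    then have "cosh (real (2 * p + 1) * t) - cosh t = 2 * sinh (real (Suc p) * t) * sinh (real p * t)"
      using cosh_add[of "real (Suc p) * t" "real p * t"] cosh_diff[of "real (Suc p) * t" "real p * t"]
      by simp
    then show "cosh (real (2 * p + 1) * t) - cosh t = sinh t * ?\<psi> t"
      unfolding cheb_U_sinh[of p t, symmetric] by algebra
  qed
  from assms have "odd (nat \<bar>k\<bar>)" by (simp add: even_nat_iff)
  then obtain p where p: "nat \<bar>k\<bar> = 2 * p + 1" by (rule oddE)
  then have "\<bar>real_of_int k\<bar> = real (2 * p + 1)" by linarith
  then have "cosh (of_int k * t) = cosh (real (2 * p + 1) * t)" for t
    by (metis abs_if cosh_minus mult_minus_left)
  with nonneg[of p] show ?thesis by (simp only:)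
qed

text \<open>\<open>X 0\<close> is the total weight, so each term of the sum contributes its weight
  times cosh (k t) - cosh t.\<close>

lemma cosh_sum_odd_quotient:
  assumes "cosh_sum False X"
  shows "\<exists>\<psi>. rising \<psi> \<and> (\<forall>t. X t - X 0 * cosh t = sinh t * \<psi> t)"
  using assms
proof (induction)
  case zero
  have "rising (\<lambda>t. 0)" by (simp add: rising_def)
  then show ?case by force
next
  case (add_cosh X w k)
  then obtain \<psi> where \<psi>: "rising \<psi>" "\<And>t. X t - X 0 * cosh t = sinh t * \<psi> t" by blast
  obtain \<phi> where \<phi>: "rising \<phi>" "\<And>t. cosh (of_int k * t) - cosh t = sinh t * \<phi> t"
    using cosh_odd_quotient[of k] add_cosh by blast
  have "rising (\<lambda>t. \<psi> t + w * \<phi> t)"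
    using \<psi> \<phi> add_cosh by (intro rising_add rising_scale)
  moreover have "X t + w * cosh (of_int k * t) - (X 0 + w * cosh (of_int k * 0)) * cosh t
      = sinh t * (\<psi> t + w * \<phi> t)" for t
    using \<psi>(2)[of t] \<phi>(2)[of t] by simp algebra
  ultimately show ?case by blast
qed

text \<open>With \<open>\<rho> = exp (2 t)\<close> and \<open>l = (n + 1) (2 R \<mu> / C - (n + 1))\<close>, the second derivative of
  \<open>f\<^sub>n\<close> satisfies \<open>f\<^sub>n'' (\<rho>) (1 - \<rho>\<^bsup>n+1\<^esup>)\<^sup>3 = - C \<rho>\<^bsup>3n/2\<^esup> curv n l t\<close>.\<close>

definition curv :: "nat \<Rightarrow> real \<Rightarrow> real \<Rightarrow> real" where
  "curv n l t = 2 * cheb_U (n + 1) t ^ 3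
     - (real n + 1)\<^sup>2 * (real n * cosh ((real n + 2) * t) + (real n + 2) * cosh (real n * t))
     - l * (real n * sinh ((real n + 2) * t) - (real n + 2) * sinh (real n * t))"

section \<open>Sign of the curvature term\<close>

lemma curv_0: "curv n l 0 = 0"
  by (simp add: curv_def cheb_U_0 power2_eq_square power3_eq_cube algebra_simps)

text \<open>By the addition formulas around frequency N = n + 1, the hyperbolic terms contribute -2
  n (n + 2) sinh (N t) (N^2 cosh t + l sinh t), and the cube contributes 6 sinh (N t) U V. Since U V
  equals N^2 (N^2 - 1) / 3 at 0 and N^2 - 1 = n (n + 2), the cosh t terms cancel and sinh t factors
  out. One \<psi> serves all \<open>l\<close>, which allows comparison with \<open>l = 0\<close>
  later.\<close>

lemma curv_derivative:
  "\<exists>\<psi>. rising \<psi> \<and> (\<forall>l t. (curv n l has_real_derivative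
     sinh ((real n + 1) * t) * sinh t * (6 * \<psi> t - 2 * real n * (real n + 2) * l)) (at t))"
proof -
  let ?N = "n + 1"
  have "cosh_sum False (\<lambda>t. cheb_U ?N t * cheb_V ?N t)"
    using cosh_sum_mult[OF cosh_sum_cheb_U[of ?N] cosh_sum_cheb_V[of ?N]] by simp
  then obtain \<psi> where \<psi>: "rising \<psi>"
    "\<And>t. cheb_U ?N t * cheb_V ?N t - cheb_U ?N 0 * cheb_V ?N 0 * cosh t = sinh t * \<psi> t"
    using cosh_sum_odd_quotient by blast
  have "(curv n l has_real_derivative
     sinh ((real n + 1) * t) * sinh t * (6 * \<psi> t - 2 * real n * (real n + 2) * l)) (at t)" for l t
  proof -
    have s: "sinh ((real n + 2) * t) = sinh ((real n + 1) * t) * cosh t + cosh ((real n + 1) * t) * sinh t"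
      "cosh ((real n + 2) * t) = cosh ((real n + 1) * t) * cosh t + sinh ((real n + 1) * t) * sinh t"
      using sinh_add[of "(real n + 1) * t" t] cosh_add[of "(real n + 1) * t" t]
      by (simp_all add: algebra_simps)
    have d: "sinh (real n * t) = sinh ((real n + 1) * t) * cosh t - cosh ((real n + 1) * t) * sinh t"
      "cosh (real n * t) = cosh ((real n + 1) * t) * cosh t - sinh ((real n + 1) * t) * sinh t"
      using sinh_diff[of "(real n + 1) * t" t] cosh_diff[of "(real n + 1) * t" t]
      by (simp_all add: algebra_simps)
    have u: "sinh ((real n + 1) * t) = cheb_U ?N t * sinh t"
      using cheb_U_sinh[of ?N t] by (simp add: add.commute)
    have uv: "cheb_U ?N t * cheb_V ?N t = sinh t * \<psi> t
        + (real n + 1) * ((real n + 1) * ((real n + 1)\<^sup>2 - 1) / 3) * cosh t"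
      using \<psi>(2)[of t] by (simp add: cheb_U_0 cheb_V_0 add.commute)
    have "(curv n l has_real_derivative
        2 * (3 * cheb_U ?N t ^ 2 * (cheb_V ?N t * sinh t))
        - (real n + 1)\<^sup>2 * (real n * (sinh ((real n + 2) * t) * (real n + 2))
            + (real n + 2) * (sinh (real n * t) * real n))
        - l * (real n * (cosh ((real n + 2) * t) * (real n + 2))
            - (real n + 2) * (cosh (real n * t) * real n))) (at t)"
      unfolding curv_def [abs_def]
      by (auto intro!: derivative_eq_intros has_derivative_cheb_U simp del: cheb_U.simps cheb_V.simps simp: algebra_simps)
    also have "2 * (3 * cheb_U ?N t ^ 2 * (cheb_V ?N t * sinh t))
        - (real n + 1)\<^sup>2 * (real n * (sinh ((real n + 2) * t) * (real n + 2))
            + (real n + 2) * (sinh (real n * t) * real n))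
        - l * (real n * (cosh ((real n + 2) * t) * (real n + 2))
            - (real n + 2) * (cosh (real n * t) * real n))
      = 6 * sinh ((real n + 1) * t) * (cheb_U ?N t * cheb_V ?N t)
        - 2 * real n * (real n + 2) * (real n + 1)\<^sup>2 * sinh ((real n + 1) * t) * cosh t
        - 2 * real n * (real n + 2) * l * sinh ((real n + 1) * t) * sinh t"
      unfolding s d by (simp add: u) algebra
    also have "\<dots> = sinh ((real n + 1) * t) * sinh t * (6 * \<psi> t - 2 * real n * (real n + 2) * l)"
      unfolding uv by (simp add: power2_eq_square algebra_simps)
    finally show ?thesis .
  qed
  with \<psi>(1) show ?thesis by blast
qed

text \<open>The function starts at 0 and falls while \<psi> < \<kappa>, so it can be nonnegative
  only after \<psi> has reached \<kappa>. From there on its derivative is positive, so once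
  nonnegative it is positive ever after. \<open>t0 = B\<close> covers the absence of a sign change
  before \<open>B\<close>.\<close>

lemma curv_sign_change:
  assumes "n \<ge> 1" "l > 0" "B > 0"
  obtains t0 where "0 < t0" "t0 \<le> B" "\<And>t. 0 < t \<Longrightarrow> t < t0 \<Longrightarrow> curv n l t < 0"
    "\<And>t. t0 < t \<Longrightarrow> t < B \<Longrightarrow> curv n l t > 0"
proof -
  \<comment> \<open>The level of \<psi> at which the derivative in \<open>curv_derivative\<close>
    changes sign.\<close>
  define \<kappa> where "\<kappa> = real n * (real n + 2) * l / 3"
  have \<kappa>: "\<kappa> > 0" using assms by (simp add: \<kappa>_def)
  obtain \<psi> where \<psi>: "rising \<psi>" and d1: "\<And>t. (curv n l has_real_derivative
      sinh ((real n + 1) * t) * sinh t * (6 * \<psi> t - 2 * real n * (real n + 2) * l)) (at t)"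
    using curv_derivative[of n] by blast
  have d2: "sinh ((real n + 1) * t) * sinh t * (6 * \<psi> t - 2 * real n * (real n + 2) * l)
      = 6 * sinh ((real n + 1) * t) * sinh t * (\<psi> t - \<kappa>)" for t
    by (simp add: \<kappa>_def field_simps)
  have der: "(curv n l has_real_derivative
      6 * sinh ((real n + 1) * t) * sinh t * (\<psi> t - \<kappa>)) (at t)" for t
    using d1[of t] unfolding d2 .
  have crit: "\<exists>z. 0 < z \<and> z < t \<and> \<psi> z \<ge> \<kappa>" if "t > 0" "curv n l t \<ge> 0" for t
  proof (rule ccontr)
    assume "\<not> ?thesis"
    then have *: "\<psi> z < \<kappa>" if "0 < z" "z < t" for z using that by force
    have "curv n l t < curv n l 0"
    proof (rule DERIV_neg_imp_decreasing_open[OF \<open>t > 0\<close>])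
      fix x assume "0 < x" "x < t"
      with * have "6 * sinh ((real n + 1) * x) * sinh x * (\<psi> x - \<kappa>) < 0"
        by (intro mult_pos_neg) auto
      with der show "\<exists>y. (curv n l has_real_derivative y) (at x) \<and> y < 0" by blast
    qed (meson DERIV_continuous_on der has_field_derivative_at_within)
    with that show False by (simp add: curv_0)
  qed
  have up: "curv n l s > 0" if t: "t > 0" "curv n l t \<ge> 0" "t < s" for s t
  proof -
    from crit t obtain z where z: "0 < z" "z < t" "\<psi> z \<ge> \<kappa>" by blast
    \<comment> \<open>A value at least \<kappa> > 0 excludes the identically zero alternative of
      \<open>rising\<close>.\<close>
    then have "strict_mono_on {0..} \<psi>" using \<psi> \<kappa> unfolding rising_def by force
    then have *: "\<psi> x > \<kappa>" if "z < x" for x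
      using z that by (fastforce dest!: strict_mono_onD[where r = z and s = x])
    have "curv n l t < curv n l s"
    proof (rule DERIV_pos_imp_increasing_open[OF \<open>t < s\<close>])
      fix x assume "t < x" "x < s"
      with * z have "6 * sinh ((real n + 1) * x) * sinh x * (\<psi> x - \<kappa>) > 0"
        by (intro mult_pos_pos) auto
      with der show "\<exists>y. (curv n l has_real_derivative y) (at x) \<and> y > 0" by blast
    qed (meson DERIV_continuous_on der has_field_derivative_at_within)
    with t show ?thesis by simp
  qed
  have "isCont \<psi> 0" "\<psi> 0 = 0"
    using \<psi> unfolding rising_def by (auto simp: continuous_on_eq_continuous_at)
  then have "eventually (\<lambda>t. \<psi> t < \<kappa>) (nhds 0)"
    using \<kappa> by (auto simp: isCont_def dest!: order_tendstoD(2)[where a = \<kappa>]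
        simp: eventually_at_filter elim!: eventually_mono)
  then obtain \<delta> where \<delta>: "\<delta> > 0" "\<And>t. \<bar>t\<bar> < \<delta> \<Longrightarrow> \<psi> t < \<kappa>"
    by (auto simp: eventually_nhds_metric dist_real_def)
  have small: "curv n l t < 0" if "0 < t" "t \<le> \<delta>" for t
    using crit[of t] \<delta>(2) that by (smt (verit))
  \<comment> \<open>Adjoining \<open>B\<close> keeps the set nonempty and its infimum at most
    \<open>B\<close>.\<close>
  define A where "A = {t. 0 < t \<and> curv n l t \<ge> 0} \<union> {B}"
  have bdd: "bdd_below A" using assms by (auto simp: A_def intro!: bdd_belowI[of _ 0])
  have A: "Inf A \<le> B" "min \<delta> B \<le> Inf A"
    using small bdd by (auto simp: A_def intro!: cInf_lower cInf_greatest) (force simp: not_less)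
  show thesis
  proof (rule that[of "Inf A"])
    show "curv n l t < 0" if "0 < t" "t < Inf A" for t
      using that bdd cInf_lower[of t A] by (force simp: A_def)
    show "curv n l t > 0" if t: "Inf A < t" "t < B" for t
    proof -
      from t obtain s where "s \<in> A" "s < t"
        by (metis A_def UnI2 cInf_lessD empty_iff insertI1)
      with t up show ?thesis by (auto simp: A_def)
    qed
  qed (use A \<delta> assms in auto)
qed

lemma cheb_U_minus: "cheb_U n (- t) = cheb_U n t"
  by (induction n t rule: cheb_U.induct) simp_all

text \<open>\<open>curv n 0\<close> is even and the rest is odd, so with s = -t > 0 the value at t
  is \<open>curv n 0 s + (curv n 0 s - curv n l s)\<close>. Both summands vanish at 0; the first has
  a nonnegative derivative, the second a positive one.\<close>

lemma curv_pos_of_neg: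
  assumes "n \<ge> 1" "l > 0" "t < 0"
  shows "curv n l t > 0"
proof -
  obtain \<psi> where \<psi>: "rising \<psi>" and der: "\<And>l t. (curv n l has_real_derivative
      sinh ((real n + 1) * t) * sinh t * (6 * \<psi> t - 2 * real n * (real n + 2) * l)) (at t)"
    using curv_derivative[of n] by blast
  have \<psi>0: "\<psi> x \<ge> 0" if "x \<ge> 0" for x
    using \<psi> that unfolding rising_def strict_mono_on_def
    by (metis atLeast_iff less_eq_real_def order_refl)
  have even: "curv n 0 0 \<le> curv n 0 (- t)"
  proof (rule DERIV_nonneg_imp_nondecreasing[where f = "curv n 0"])
    fix x assume "0 \<le> x" "x \<le> - t"
    then have "sinh ((real n + 1) * x) * sinh x * (6 * \<psi> x - 2 * real n * (real n + 2) * 0) \<ge> 0"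
      using \<psi>0 by simp
    with der show "\<exists>y. (curv n 0 has_real_derivative y) (at x) \<and> y \<ge> 0" by blast
  qed (use assms in simp)
  have "curv n 0 0 - curv n l 0 < curv n 0 (- t) - curv n l (- t)"
  proof (rule DERIV_pos_imp_increasing_open[where f = "\<lambda>x. curv n 0 x - curv n l x"])
    fix x assume x: "0 < x" "x < - t"
    have "((\<lambda>x. curv n 0 x - curv n l x) has_real_derivative
        2 * real n * (real n + 2) * l * sinh ((real n + 1) * x) * sinh x) (at x)"
      by (rule derivative_eq_intros der refl)+ (simp add: algebra_simps)
    moreover have "2 * real n * (real n + 2) * l * sinh ((real n + 1) * x) * sinh x > 0"
      using x assms by simp
    ultimately show "\<exists>y. ((\<lambda>x. curv n 0 x - curv n l x) has_real_derivative y) (at x) \<and> y > 0"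
      by blast
  qed (use assms in simp, intro continuous_intros, (meson DERIV_continuous_on der has_field_derivative_at_within)+)
  with even have "2 * curv n 0 (- t) > curv n l (- t)"
    by (simp add: curv_0)
  moreover have "curv n l t = 2 * curv n 0 (- t) - curv n l (- t)"
    unfolding curv_def cheb_U_minus mult_minus_right cosh_minus sinh_minus by algebra
  ultimately show ?thesis by simp
qed

section \<open>The benefit rate and its curvature\<close>

text \<open>For the M/M/1/n queue with load x, \<open>gsum\<close> is the normalising constant of
  the stationary law and \<open>gsum1 / gsum\<close> the mean number of customers. These polynomials
  remove the singularity at 1.\<close>

definition gsum :: "nat \<Rightarrow> real \<Rightarrow> real" where "gsum n x = (\<Sum>k\<le>n. x ^ k)"
definition gsum1 :: "nat \<Rightarrow> real \<Rightarrow> real" where "gsum1 n x = (\<Sum>k\<le>n. real k * x ^ k)"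

lemma gsum_closed: "(1 - x) * gsum n x = 1 - x ^ (n + 1)"
proof (induction n)
  case (Suc n)
  have "gsum (Suc n) x = gsum n x + x ^ (n + 1)" by (simp add: gsum_def)
  then have "(1 - x) * gsum (Suc n) x = 1 - x ^ (n + 1) + (1 - x) * x ^ (n + 1)"
    by (simp only: distrib_left Suc)
  then show ?case by (simp add: algebra_simps)
qed (simp add: gsum_def)

lemma gsum1_closed: "(1 - x) * gsum1 n x = gsum n x - 1 - real n * x ^ (n + 1)"
proof (induction n)
  case (Suc n)
  have g: "gsum (Suc n) x = gsum n x + x ^ (n + 1)" "gsum1 (Suc n) x = gsum1 n x + (real n + 1) * x ^ (n + 1)"
    by (simp_all add: gsum_def gsum1_def)
  then have "(1 - x) * gsum1 (Suc n) x = gsum n x - 1 - real n * x ^ (n + 1)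
      + (1 - x) * ((real n + 1) * x ^ (n + 1))"
    by (simp only: distrib_left Suc)
  then show ?case unfolding g(1) by (simp add: algebra_simps)
qed (simp add: gsum_def gsum1_def)

lemma power_Suc_neq_1:
  fixes x :: real
  assumes "x > -1" "x \<noteq> 1"
  shows "x ^ (n + 1) \<noteq> 1"
proof
  assume "x ^ (n + 1) = 1"
  then have "\<bar>x\<bar> ^ (n + 1) = 1 ^ (n + 1)" by (simp del: power_Suc flip: power_abs)
  then have "\<bar>x\<bar> = 1" by (rule power_eq_imp_eq_base) auto
  with assms show False by linarith
qed

lemma gsum_neq_0:
  assumes "x > -1"
  shows "gsum n x \<noteq> 0"
  using gsum_closed[of x n] power_Suc_neq_1[of x n] assms by (cases "x = 1") (auto simp: gsum_def)

text \<open>The range x > -1 contains a neighbourhood of 0, so that two-sided derivatives exist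
  there too, as needed when a = 0.\<close>

lemma benefit_rate_gsum:
  assumes "x > -1"
  shows "benefit_rate R C \<mu> n x = R * \<mu> * (1 - 1 / gsum n x) - C * (gsum1 n x / gsum n x)"
proof (cases "x = 1")
  case True
  have "real (\<Sum>k\<le>n. k) = real n * (real n + 1) / 2"
    by (induction n) (auto simp: field_simps)
  then have "gsum1 n 1 = real n * (real n + 1) / 2" by (simp add: gsum1_def)
  moreover have "gsum n 1 = real n + 1" by (simp add: gsum_def)
  moreover have "1 - 1 / (real n + 1) = real n / (real n + 1)"
    "real n * (real n + 1) / 2 / (real n + 1) = real n / 2" by (simp_all add: divide_simps)
  ultimately show ?thesis using True by (simp only: benefit_rate_def if_True refl)
next
  case False
  define q where "q = x ^ (n + 1)"
  have q: "q \<noteq> 1" using power_Suc_neq_1[OF assms False] by (simp add: q_def)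
  have S: "gsum n x = (1 - q) / (1 - x)"
    using gsum_closed[of x n] False by (simp add: q_def field_simps)
  have M: "gsum1 n x = (gsum n x - 1 - real n * q) / (1 - x)"
    using gsum1_closed[of x n] False by (simp add: q_def field_simps)
  have q': "x * (1 - x ^ n) = x - q" by (simp add: q_def algebra_simps)
  have "R * \<mu> * ((x - q) / (1 - q)) = R * \<mu> * (1 - 1 / gsum n x)"
    using q False by (simp add: S field_simps)
  moreover have "x / (1 - x) - (real n + 1) * q / (1 - q) = gsum1 n x / gsum n x"
    unfolding M S using q False by (simp add: divide_simps) algebra
  ultimately show ?thesis
    using False by (simp only: benefit_rate_def if_False q' q_def[symmetric])
qed

text \<open>The quotient rule applied to the \<open>gsum\<close> form, hence valid at 1 as well. The
  truncated exponent \<open>k - 1\<close> at k = 0 is harmless because its coefficient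
  vanishes.\<close>

definition benefit_slope :: "real \<Rightarrow> real \<Rightarrow> real \<Rightarrow> nat \<Rightarrow> real \<Rightarrow> real" where
  "benefit_slope R C \<mu> n x =
     (let S = gsum n x; M = gsum1 n x;
          S' = (\<Sum>k\<le>n. real k * x ^ (k - 1)); M' = (\<Sum>k\<le>n. real k * (real k * x ^ (k - 1)))
      in (R * \<mu> * S' - C * (M' * S - M * S')) / S\<^sup>2)"

lemma benefit_rate_derivative:
  assumes "x > -1"
  shows "(benefit_rate R C \<mu> n has_real_derivative benefit_slope R C \<mu> n x) (at x)"
proof -
  have S: "(gsum n has_real_derivative (\<Sum>k\<le>n. real k * x ^ (k - 1))) (at x)"
    unfolding gsum_def [abs_def] by (auto intro!: derivative_eq_intros)
  have M: "(gsum1 n has_real_derivative (\<Sum>k\<le>n. real k * (real k * x ^ (k - 1)))) (at x)"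
    unfolding gsum1_def [abs_def] by (auto intro!: derivative_eq_intros simp: ac_simps)
  note S0 = gsum_neq_0[OF assms, of n]
  let ?S' = "\<Sum>k\<le>n. real k * x ^ (k - 1)" and ?M' = "\<Sum>k\<le>n. real k * (real k * x ^ (k - 1))"
  have "((\<lambda>x. R * \<mu> * (1 - 1 / gsum n x) - C * (gsum1 n x / gsum n x)) has_real_derivative
      R * \<mu> * (0 - (0 * gsum n x - 1 * ?S') / (gsum n x * gsum n x))
      - C * ((?M' * gsum n x - gsum1 n x * ?S') / (gsum n x * gsum n x))) (at x)"
    by (intro DERIV_diff DERIV_cmult DERIV_divide S M S0 DERIV_const)
  also have "R * \<mu> * (0 - (0 * gsum n x - 1 * ?S') / (gsum n x * gsum n x))
      - C * ((?M' * gsum n x - gsum1 n x * ?S') / (gsum n x * gsum n x))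
      = benefit_slope R C \<mu> n x"
  proof -
    have "p * (0 - (0 * z - 1 * s) / t) - c * (u / t) = (p * s - c * u) / t" for p z s t c u :: real
      by (simp add: diff_divide_distrib)
    then show ?thesis unfolding benefit_slope_def Let_def power2_eq_square by blast
  qed
  finally have "((\<lambda>x. R * \<mu> * (1 - 1 / gsum n x) - C * (gsum1 n x / gsum n x)) has_real_derivative
      benefit_slope R C \<mu> n x) (at x)" .
  then show ?thesis
    by (rule has_field_derivative_transform_within_open[where S = "{-1<..}"])
      (use assms in \<open>auto simp: benefit_rate_gsum\<close>)
qed

lemma continuous_on_benefit_slope: "continuous_on {0..} (benefit_slope R C \<mu> n)"
proof -
  have "continuous_on A (gsum n)" "continuous_on A (gsum1 n)" for A
    unfolding gsum_def [abs_def] gsum1_def [abs_def] by (intro continuous_intros)+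
  then show ?thesis unfolding benefit_slope_def [abs_def] Let_def
    by (intro continuous_intros) (auto simp: gsum_neq_0)
qed

text \<open>At t = ln y every hyperbolic function becomes a Laurent polynomial in \<open>y\<close>
  and \<open>Y\<close>, and the prefactor (Y / y)^3 = y^(3n) turns \<open>cheb_U\<close> into (1 -
  Y^2) / (1 - y^2). The right-hand side is the shape in which the second derivative of the rate
  arises, with r standing for R \<mu> / C.\<close>

lemma curv_exp_form:
  fixes y r :: real and n :: nat
  assumes y: "y > 0" "y \<noteq> 1"
  defines "Y \<equiv> y ^ (n + 1)" and "N \<equiv> real n + 1"
  shows "(Y / y) ^ 3 * curv n (N * (2 * r - N)) (ln y)
    = 2 * ((1 - Y\<^sup>2) / (1 - y\<^sup>2)) ^ 3
      - N * Y\<^sup>2 / y ^ 4 * (N * (N - 1 + (N + 1) * Y\<^sup>2)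
          - r * ((N - 1) * (1 - Y\<^sup>2 * y\<^sup>2) - (N + 1) * (y\<^sup>2 - Y\<^sup>2)))"
proof -
  have Y: "Y > 0" using y by (simp add: Y_def)
  have e: "exp (real k * ln y) = y ^ k" for k
    using y by (simp add: exp_of_nat_mult)
  have sh: "sinh (real k * ln y) = (y ^ k - inverse (y ^ k)) / 2"
    and ch: "cosh (real k * ln y) = (y ^ k + inverse (y ^ k)) / 2" for k
    by (simp_all add: sinh_def cosh_def exp_minus e)
  have p: "y ^ (n + 2) = Y * y" "y ^ n = Y / y" using y by (simp_all add: Y_def)
  define u where "u = cheb_U (n + 1) (ln y)"
  have "u * ((y - inverse y) / 2) = (Y - inverse Y) / 2"
    using cheb_U_sinh[of "n + 1" "ln y"] sh[of "n + 1"] sh[of 1]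
    unfolding Y_def[symmetric] u_def of_nat_1 power_one_right mult_1 by metis
  then have "u * (y * y - 1) * Y = (Y * Y - 1) * y"
    using y Y by (simp add: field_simps)
  moreover have "y\<^sup>2 \<noteq> 1" using y by (simp add: power2_eq_1_iff)
  ultimately have U: "u * (Y / y) = (1 - Y\<^sup>2) / (1 - y\<^sup>2)"
    using y by (simp add: divide_simps power2_eq_square) algebra
  have u3: "(Y / y) ^ 3 * (2 * u ^ 3) = 2 * ((1 - Y\<^sup>2) / (1 - y\<^sup>2)) ^ 3"
    unfolding U[symmetric] by (simp add: power_mult_distrib power_divide)
  \<comment> \<open>The common factor that leaves only polynomials in y^2 and Y^2.\<close>
  define K where "K = Y\<^sup>2 / y ^ 4"
  have K: "(Y / y) ^ 3 * (Y * y) = K * (Y\<^sup>2 * y\<^sup>2)" "(Y / y) ^ 3 * inverse (Y * y) = K"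
    "(Y / y) ^ 3 * (Y / y) = K * Y\<^sup>2" "(Y / y) ^ 3 * inverse (Y / y) = K * y\<^sup>2"
    using y Y by (simp_all add: K_def field_simps eval_nat_numeral)
  have half: "p * ((q + s) / 2) = (p * q + p * s) / 2" "p * ((q - s) / 2) = (p * q - p * s) / 2"
    for p q s :: real by (simp_all add: algebra_simps)
  have "real (n + 2) = real n + 2" by simp
  then have c: "(Y / y) ^ 3 * cosh ((real n + 2) * ln y) = (K * (Y\<^sup>2 * y\<^sup>2) + K) / 2"
    "(Y / y) ^ 3 * sinh ((real n + 2) * ln y) = (K * (Y\<^sup>2 * y\<^sup>2) - K) / 2"
    "(Y / y) ^ 3 * cosh (real n * ln y) = (K * Y\<^sup>2 + K * y\<^sup>2) / 2"
    "(Y / y) ^ 3 * sinh (real n * ln y) = (K * Y\<^sup>2 - K * y\<^sup>2) / 2"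
    using sh[of "n + 2"] ch[of "n + 2"] sh[of n] ch[of n] unfolding p
    by (simp_all only: half K)
  have "(Y / y) ^ 3 * (N\<^sup>2 * (real n * cosh ((real n + 2) * ln y) + (real n + 2) * cosh (real n * ln y))
       + N * (2 * r - N) * (real n * sinh ((real n + 2) * ln y) - (real n + 2) * sinh (real n * ln y)))
     = N\<^sup>2 * (real n * ((Y / y) ^ 3 * cosh ((real n + 2) * ln y))
          + (real n + 2) * ((Y / y) ^ 3 * cosh (real n * ln y)))
       + N * (2 * r - N) * (real n * ((Y / y) ^ 3 * sinh ((real n + 2) * ln y))
          - (real n + 2) * ((Y / y) ^ 3 * sinh (real n * ln y)))"
    by (simp only: algebra_simps)
  also have "\<dots> = N * K * (N * (N - 1 + (N + 1) * Y\<^sup>2)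
          - r * ((N - 1) * (1 - Y\<^sup>2 * y\<^sup>2) - (N + 1) * (y\<^sup>2 - Y\<^sup>2)))"
    unfolding c by (simp add: N_def field_simps power2_eq_square)
  finally have "(Y / y) ^ 3 * (N\<^sup>2 * (real n * cosh ((real n + 2) * ln y) + (real n + 2) * cosh (real n * ln y))
       + N * (2 * r - N) * (real n * sinh ((real n + 2) * ln y) - (real n + 2) * sinh (real n * ln y)))
     = N * Y\<^sup>2 / y ^ 4 * (N * (N - 1 + (N + 1) * Y\<^sup>2)
          - r * ((N - 1) * (1 - Y\<^sup>2 * y\<^sup>2) - (N + 1) * (y\<^sup>2 - Y\<^sup>2)))"
    by (simp add: K_def)
  with u3 show ?thesis
    unfolding curv_def N_def[symmetric] u_def[symmetric]
    by (simp only: diff_diff_eq right_diff_distrib)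
qed

text \<open>Off 1 the rate is affine in \<open>v x = 1 / (1 - x ^ (n + 1))\<close> apart from 1 / (1
  - x). Two differentiations produce at most the third power of v, which the factor on the left
  clears; x = y^2 then leads to \<open>curv_exp_form\<close>.\<close>

lemma benefit_slope_derivative:
  assumes x: "x > 0" "x \<noteq> 1" and C: "C > 0"
  shows "\<exists>D. (benefit_slope R C \<mu> n has_real_derivative D) (at x) \<and>
    D * (1 - x ^ (n + 1)) ^ 3 = - C * (x ^ n * sqrt x ^ n
      * curv n ((real n + 1) * (2 * (R * \<mu> / C) - (real n + 1))) (ln x / 2))"
proof -
  define N where "N = real n + 1"
  \<comment> \<open>Since v' = N x^n v^2, the derivatives \<open>v1\<close> and \<open>v2\<close>
    are polynomials in v.\<close>
  define v where "v = (\<lambda>x::real. 1 / (1 - x ^ (n + 1)))"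
  define v1 where "v1 = (\<lambda>x. N * x ^ n * (v x)\<^sup>2)"
  define v2 where "v2 = (\<lambda>x. N * real n * x ^ (n - 1) * (v x)\<^sup>2 + 2 * N * x ^ n * v x * v1 x)"
  have v: "(v has_real_derivative v1 x) (at x)" if "x > 0" "x \<noteq> 1" for x
    using that power_Suc_neq_1[of x n] unfolding v_def v1_def
    by (auto intro!: derivative_eq_intros simp: N_def power2_eq_square field_simps simp del: power_Suc)
  have v1: "(v1 has_real_derivative v2 x) (at x)" if "x > 0" "x \<noteq> 1" for x
    using that unfolding v1_def [abs_def] v2_def
    by (auto intro!: derivative_eq_intros v simp: v1_def algebra_simps)
  have slope: "benefit_slope R C \<mu> n x
      = R * \<mu> * (v x - (1 - x) * v1 x) - C * (1 / (1 - x)\<^sup>2 - N * v1 x)"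
    if x: "x > 0" "x \<noteq> 1" for x
  proof -
    have "((\<lambda>x. R * \<mu> * (1 - (1 - x) * v x) - C * (1 / (1 - x) - N * v x + real n))
        has_real_derivative R * \<mu> * (v x - (1 - x) * v1 x) - C * (1 / (1 - x)\<^sup>2 - N * v1 x)) (at x)"
      using x by (auto intro!: derivative_eq_intros v simp: power2_eq_square algebra_simps)
    then have "(benefit_rate R C \<mu> n has_real_derivative
        R * \<mu> * (v x - (1 - x) * v1 x) - C * (1 / (1 - x)\<^sup>2 - N * v1 x)) (at x)"
    proof (rule has_field_derivative_transform_within_open[where S = "{0<..} - {1}"])
      fix z :: real assume z: "z \<in> {0<..} - {1}"
      define q where "q = z ^ (n + 1)"
      have q: "q \<noteq> 1" using power_Suc_neq_1[of z n] z by (simp add: q_def)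
      have q': "z * (1 - z ^ n) = z - q" by (simp add: q_def algebra_simps)
      have "(z - q) / (1 - q) = 1 - (1 - z) * (1 / (1 - q))"
        using q by (simp add: field_simps)
      moreover have "z / (1 - z) - (real n + 1) * q / (1 - q)
          = 1 / (1 - z) - N * (1 / (1 - q)) + real n"
        using q z by (simp add: N_def divide_simps) algebra
      ultimately show "R * \<mu> * (1 - (1 - z) * v z) - C * (1 / (1 - z) - N * v z + real n)
          = benefit_rate R C \<mu> n z"
        using z unfolding benefit_rate_def q' v_def q_def[symmetric] by simp
    qed (use x in \<open>auto intro!: open_Diff\<close>)
    with benefit_rate_derivative[of x R C \<mu> n] x show ?thesis
      by (metis DERIV_unique less_trans neg_less_0_iff_less zero_less_one)
  qed
  define D where "D = R * \<mu> * (2 * v1 x - (1 - x) * v2 x) - C * (2 / (1 - x) ^ 3 - N * v2 x)"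
  have "((\<lambda>x. inverse (1 - x) ^ 2) has_real_derivative 2 * inverse (1 - x) ^ 3) (at x)"
    using x by (auto intro!: derivative_eq_intros simp: eval_nat_numeral)
  then have "((\<lambda>x. 1 / (1 - x)\<^sup>2) has_real_derivative 2 / (1 - x) ^ 3) (at x)"
    by (simp add: inverse_eq_divide power_divide)
  then have "((\<lambda>x. R * \<mu> * (v x - (1 - x) * v1 x) - C * (1 / (1 - x)\<^sup>2 - N * v1 x))
      has_real_derivative R * \<mu> * (v1 x - ((0 - 1) * v1 x + v2 x * (1 - x)))
        - C * (2 / (1 - x) ^ 3 - N * v2 x)) (at x)"
    using x by (intro DERIV_diff DERIV_cmult DERIV_mult v v1 DERIV_const DERIV_ident)
  then have "((\<lambda>x. R * \<mu> * (v x - (1 - x) * v1 x) - C * (1 / (1 - x)\<^sup>2 - N * v1 x))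
      has_real_derivative D) (at x)"
    by (simp add: D_def algebra_simps)
  then have deriv: "(benefit_slope R C \<mu> n has_real_derivative D) (at x)"
    by (rule has_field_derivative_transform_within_open[where S = "{0<..} - {1}"])
      (use x slope in \<open>auto intro!: open_Diff\<close>)
  define y where "y = sqrt x"
  define Y where "Y = y ^ (n + 1)"
  have y: "y > 0" "y \<noteq> 1" "x = y\<^sup>2" "y \<noteq> 0" using x by (auto simp: y_def)
  have ln: "ln x / 2 = ln y" using x by (simp add: y_def ln_sqrt)
  have Y: "x ^ (n + 1) = Y\<^sup>2" "x ^ n = Y\<^sup>2 / y\<^sup>2" "Y \<noteq> 0"
    using y by (simp_all add: Y_def power_mult_distrib mult.commute flip: power_mult)
  have Y2: "1 - Y\<^sup>2 \<noteq> 0" using power_Suc_neq_1[of x n] x Y by auto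
  have y2: "1 - y\<^sup>2 \<noteq> 0" using x y by auto
  \<comment> \<open>The factor \<open>real n\<close> settles n = 0, where the exponent is
    truncated.\<close>
  have nx: "real n * x ^ (n - 1) = real n * (Y\<^sup>2 / y ^ 4)"
    using Y(2) y by (cases n) (auto simp: field_simps power2_eq_square power4_eq_xxxx)
  define K where "K = Y\<^sup>2 / y ^ 4"
  have K: "Y\<^sup>2 / y\<^sup>2 = K * y\<^sup>2" using y(4) by (simp add: K_def eval_nat_numeral)
  have KK: "(Y\<^sup>2 / y\<^sup>2)\<^sup>2 = K * Y\<^sup>2" using y(4) by (simp add: K_def eval_nat_numeral)
  define r where "r = R * \<mu> / C"
  have r: "R * \<mu> = r * C" using C by (simp add: r_def)
  have vx: "v x = 1 / (1 - Y\<^sup>2)" by (simp only: v_def Y)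
  have vY: "v x * (1 - Y\<^sup>2) = 1" using Y2 by (simp add: vx)
  have "v1 x * (1 - Y\<^sup>2) ^ 3 = N * x ^ n * (v x * (1 - Y\<^sup>2))\<^sup>2 * (1 - Y\<^sup>2)"
    unfolding v1_def by (simp add: power2_eq_square power3_eq_cube algebra_simps)
  then have v1x: "v1 x * (1 - Y\<^sup>2) ^ 3 = N * (K * y\<^sup>2) * (1 - Y\<^sup>2)"
    unfolding vY Y K by simp
  have "v2 x * (1 - Y\<^sup>2) ^ 3 = N * (real n * x ^ (n - 1)) * (v x * (1 - Y\<^sup>2))\<^sup>2 * (1 - Y\<^sup>2)
      + 2 * N\<^sup>2 * (x ^ n)\<^sup>2 * (v x * (1 - Y\<^sup>2)) ^ 3"
    unfolding v2_def v1_def by (simp add: power2_eq_square power3_eq_cube algebra_simps)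
  then have v2x: "v2 x * (1 - Y\<^sup>2) ^ 3 = N * K * ((N - 1) * (1 - Y\<^sup>2) + 2 * N * Y\<^sup>2)"
    unfolding vY nx Y(2) KK K_def[symmetric]
    by (simp add: N_def power2_eq_square algebra_simps)
  have "D * (1 - Y\<^sup>2) ^ 3 = - C * (2 * ((1 - Y\<^sup>2) / (1 - y\<^sup>2)) ^ 3
      - N * (v2 x * (1 - Y\<^sup>2) ^ 3)
      - r * (2 * (v1 x * (1 - Y\<^sup>2) ^ 3) - (1 - y\<^sup>2) * (v2 x * (1 - Y\<^sup>2) ^ 3)))"
    unfolding D_def r y(3)[symmetric] by (simp add: power_divide algebra_simps)
  also have "\<dots> = - C * (2 * ((1 - Y\<^sup>2) / (1 - y\<^sup>2)) ^ 3
      - N * K * (N * (N - 1 + (N + 1) * Y\<^sup>2)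
          - r * ((N - 1) * (1 - Y\<^sup>2 * y\<^sup>2) - (N + 1) * (y\<^sup>2 - Y\<^sup>2))))"
    unfolding v1x v2x by algebra
  also have "\<dots> = - C * ((Y / y) ^ 3 * curv n (N * (2 * r - N)) (ln y))"
    using curv_exp_form[OF y(1,2), of n r] by (simp add: Y_def N_def K_def)
  also have "(Y / y) ^ 3 = x ^ n * sqrt x ^ n"
    using y by (simp add: Y_def y_def[symmetric] power3_eq_cube power2_eq_square power_mult_distrib)
  finally have "D * (1 - x ^ (n + 1)) ^ 3 = - C * (x ^ n * sqrt x ^ n
      * curv n ((real n + 1) * (2 * (R * \<mu> / C) - (real n + 1))) (ln x / 2))"
    unfolding Y ln N_def r_def .
  with deriv show ?thesis by blast
qed

text \<open>The bound on R \<mu> / C makes l positive. The second derivative at x has the sign of (x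
  - 1) times \<open>curv\<close> at ln x / 2: negative below 1, and above 1 first negative, then
  positive, with the change at \<open>exp (2 * t0)\<close>. If b <= 1, then c = b and the convex
  part is a single point.\<close>

lemma benefit_slope_monotonicity:
  assumes "C > 0" "n \<ge> 1" "R * \<mu> / C \<ge> real n + 1" and m: "m \<le> 1" "m < b" "0 \<le> m"
  obtains c where "m < c" "c \<le> b" "strict_antimono_on {0..c} (benefit_slope R C \<mu> n)"
    "strict_mono_on {c..b} (benefit_slope R C \<mu> n)"
proof -
  define l where "l = (real n + 1) * (2 * (R * \<mu> / C) - (real n + 1))"
  let ?g = "benefit_slope R C \<mu> n"
  have l: "l > 0" using assms unfolding l_def by (intro mult_pos_pos) auto
  have key: "\<exists>D. (?g has_real_derivative D) (at x) \<and>
      sgn D = sgn ((x - 1) * curv n l (ln x / 2))" if x: "x > 0" "x \<noteq> 1" for x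
  proof -
    from benefit_slope_derivative[OF x \<open>C > 0\<close>, of R \<mu> n, folded l_def] obtain D where
      D: "(?g has_real_derivative D) (at x)" and
      e: "D * (1 - x ^ (n + 1)) ^ 3 = - C * (x ^ n * sqrt x ^ n * curv n l (ln x / 2))" by blast
    have "sgn (1 - x ^ (n + 1)) = sgn (1 - x)"
    proof (cases "x < 1")
      case True
      then have "x ^ (n + 1) < 1" using x power_Suc_less_one[of x n] by simp
      with True show ?thesis by simp
    next
      case False
      then have "x ^ (n + 1) > 1" using x by (intro one_less_power) auto
      with False x show ?thesis by simp
    qed
    moreover have "sgn (y ^ 3) = sgn y" for y :: real
      by (simp add: sgn_if power_less_zero_eq zero_less_power_eq)
    ultimately have "sgn ((1 - x ^ (n + 1)) ^ 3) = sgn (1 - x)" by metis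
    moreover have "sgn (x ^ n * sqrt x ^ n) = 1" using x by simp
    ultimately have "sgn D * sgn (1 - x) = - sgn (curv n l (ln x / 2))"
      using arg_cong[OF e, of sgn] \<open>C > 0\<close> unfolding sgn_mult[of D] sgn_mult[of "- C"]
        sgn_mult[of "x ^ n * sqrt x ^ n"] by simp
    then have "sgn D = sgn ((x - 1) * curv n l (ln x / 2))"
      using x by (cases "x < 1") (auto simp: sgn_mult)
    with D show ?thesis by blast
  qed
  have cont: "continuous_on {u..v} ?g" if "u \<ge> 0" for u v
    using continuous_on_benefit_slope by (rule continuous_on_subset) (use that in auto)
  have dec: "?g v < ?g u" if "0 \<le> u" "u < v"
    and "\<And>x. u < x \<Longrightarrow> x < v \<Longrightarrow> x \<noteq> 1 \<and> (x - 1) * curv n l (ln x / 2) < 0" for u v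
  proof (rule DERIV_neg_imp_decreasing_open[OF \<open>u < v\<close>])
    fix x assume "u < x" "x < v"
    with that key[of x] show "\<exists>y. (?g has_real_derivative y) (at x) \<and> y < 0"
      by (metis le_less_trans sgn_less)
  qed (use that cont in auto)
  have inc: "?g u < ?g v" if "0 \<le> u" "u < v"
    and "\<And>x. u < x \<Longrightarrow> x < v \<Longrightarrow> x \<noteq> 1 \<and> (x - 1) * curv n l (ln x / 2) > 0" for u v
  proof (rule DERIV_pos_imp_increasing_open[OF \<open>u < v\<close>])
    fix x assume "u < x" "x < v"
    with that key[of x] show "\<exists>y. (?g has_real_derivative y) (at x) \<and> y > 0"
      by (metis le_less_trans sgn_greater)
  qed (use that cont in auto)
  have low: "?g v < ?g u" if "0 \<le> u" "u < v" "v \<le> 1" for u v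
  proof (rule dec)
    fix x assume "u < x" "x < v"
    with that have "x < 1" "ln x / 2 < 0" by auto
    with curv_pos_of_neg[OF \<open>n \<ge> 1\<close> l] show "x \<noteq> 1 \<and> (x - 1) * curv n l (ln x / 2) < 0"
      by (simp add: mult_neg_pos)
  qed (use that in auto)
  show thesis
  proof (cases "b \<le> 1")
    case True
    show thesis
      by (rule that[of b]) (use m True low in \<open>auto simp: monotone_on_def\<close>)
  next
    case False
    then obtain t0 where t0: "0 < t0" "t0 \<le> ln b / 2" "\<And>t. 0 < t \<Longrightarrow> t < t0 \<Longrightarrow> curv n l t < 0"
      "\<And>t. t0 < t \<Longrightarrow> t < ln b / 2 \<Longrightarrow> curv n l t > 0"
      using curv_sign_change[OF \<open>n \<ge> 1\<close> l, of "ln b / 2"] by auto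
    define c where "c = exp (2 * t0)"
    have c: "1 < c" "c \<le> b" "ln c = 2 * t0"
      using t0 False by (auto simp: c_def)
        (metis exp_le_cancel_iff exp_ln less_trans not_less zero_less_one mult.commute
          le_divide_eq_numeral1(1))
    have mid: "?g v < ?g u" if "1 \<le> u" "u < v" "v \<le> c" for u v
    proof (rule dec)
      fix x assume x: "u < x" "x < v"
      with that c have "ln x < ln c" by (subst ln_less_cancel_iff) auto
      with x that c t0(3)[of "ln x / 2"] show "x \<noteq> 1 \<and> (x - 1) * curv n l (ln x / 2) < 0"
        by (auto intro!: mult_pos_neg)
    qed (use that in auto)
    have high: "?g u < ?g v" if "c \<le> u" "u < v" "v \<le> b" for u v
    proof (rule inc)
      fix x assume x: "u < x" "x < v"
      with that c have "ln c < ln x" "ln x < ln b"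
        by (subst ln_less_cancel_iff; linarith)+
      with x that c t0(4)[of "ln x / 2"] show "x \<noteq> 1 \<and> (x - 1) * curv n l (ln x / 2) > 0"
        by (auto intro!: mult_pos_pos)
    qed (use that c in auto)
    \<comment> \<open>An interval with 1 inside is split there, as the sign formula excludes x =
      1.\<close>
    have "?g v < ?g u" if "0 \<le> u" "u < v" "v \<le> c" for u v
      using low[of u v] mid[of u v] low[of u 1] mid[of 1 v] that
      by (cases "u < 1"; cases "v > 1") auto
    then show thesis
      by (intro that[of c]) (use m c high in \<open>auto simp: monotone_on_def\<close>)
  qed
qed

section \<open>Concave-convex functions\<close>

locale concave_convex =
  fixes f g :: "real \<Rightarrow> real" and a m b c :: real
  assumes order: "a < m" "m < c" "c \<le> b"
    and der: "\<And>x. a \<le> x \<Longrightarrow> x \<le> b \<Longrightarrow> (f has_real_derivative g x) (at x)"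
    and dec: "strict_antimono_on {a..c} g"
    and inc: "strict_mono_on {c..b} g"
    and cont_g: "continuous_on {a..b} g"
begin

lemma mean_value:
  assumes "a \<le> x" "x < y" "y \<le> b"
  obtains z where "x < z" "z < y" "f y - f x = g z * (y - x)"
  using MVT2[OF \<open>x < y\<close>, of f g] der assms by (metis less_imp_le mult.commute order_trans)

lemma slope_dec: "a \<le> x \<Longrightarrow> x < y \<Longrightarrow> y \<le> c \<Longrightarrow> g y < g x"
  using dec order by (auto simp: monotone_on_def)

lemma slope_inc: "c \<le> x \<Longrightarrow> x < y \<Longrightarrow> y \<le> b \<Longrightarrow> g x < g y"
  using inc order by (auto simp: monotone_on_def)

text \<open>By concavity the mean slope left of y exceeds that right of y. If the left one is at
  least s, the bound carries over from x; otherwise the right one is below s and the bound carries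
  back from z.\<close>

lemma above_chord:
  assumes "a \<le> x" "x \<le> y" "y \<le> z" "z \<le> c"
    and "u + s * x \<le> f x" "u + s * z \<le> f z"
  shows "u + s * y \<le> f y"
proof (cases "x < y \<and> y < z")
  case True
  obtain p where p: "x < p" "p < y" "f y - f x = g p * (y - x)"
    using mean_value[of x y] assms True order by auto
  obtain q where q: "y < q" "q < z" "f z - f y = g q * (z - y)"
    using mean_value[of y z] assms True order by auto
  have "g q < g p" using slope_dec p q assms by auto
  show ?thesis
  proof (cases "g p \<ge> s")
    case True
    then have "g p * (y - x) \<ge> s * (y - x)" using p by (intro mult_right_mono) auto
    with p assms show ?thesis by (simp add: algebra_simps)
  next
    case False
    with \<open>g q < g p\<close> have "g q * (z - y) \<le> s * (z - y)" using q by (intro mult_right_mono) auto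
    with q assms show ?thesis by (simp add: algebra_simps)
  qed
next
  case False
  with assms have "y = x \<or> y = z" by linarith
  with assms show ?thesis by auto
qed

lemma above_tangent:
  assumes "c \<le> x" "x \<le> b" "c \<le> y" "y \<le> b"
  shows "f x + g x * (y - x) \<le> f y"
proof (cases x y rule: linorder_cases)
  case less
  obtain p where p: "x < p" "p < y" "f y - f x = g p * (y - x)"
    using mean_value[of x y] assms less order by auto
  then have "g x \<le> g p" using slope_inc[of x p] assms by auto
  then have "g x * (y - x) \<le> g p * (y - x)" using less by (intro mult_right_mono) auto
  with p show ?thesis by linarith
next
  case greater
  obtain p where p: "y < p" "p < x" "f x - f y = g p * (x - y)"
    using mean_value[of y x] assms greater order by auto
  then have "g p \<le> g x" using slope_inc[of p x] assms by auto
  then have "g p * (x - y) \<le> g x * (x - y)" using greater by (intro mult_right_mono) auto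
  with p show ?thesis by (simp add: algebra_simps)
qed simp

text \<open>Height of the tangent at x above f, measured at abscissa m. Its zeros on (m, b] are the
  tangent points, and its sign at b separates case 1 from the others.\<close>

definition gap :: "real \<Rightarrow> real" where "gap x = f x + g x * (m - x) - f m"

lemma gap_pos:
  assumes "m < x" "x \<le> c"
  shows "gap x > 0"
proof -
  obtain p where p: "m < p" "p < x" "f x - f m = g p * (x - m)"
    using mean_value[of m x] assms order by auto
  then have "g x < g p" using slope_dec[of p x] assms order by auto
  then have "g x * (x - m) < g p * (x - m)" using assms by (intro mult_strict_right_mono) auto
  with p show ?thesis by (simp add: gap_def algebra_simps)
qed

text \<open>At x the tangent at y is not above f, and it is steeper than the tangent at x; hence it
  is lower at m.\<close>

lemma gap_dec:
  assumes "c \<le> x" "x < y" "y \<le> b"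
  shows "gap y < gap x"
proof -
  have "f x + g x * (y - x) \<le> f y" "f y + g y * (x - y) \<le> f x"
    using above_tangent assms by auto
  moreover have "g x * (x - m) < g y * (x - m)"
    using slope_inc[of x y] assms order by (intro mult_strict_right_mono) auto
  ultimately show ?thesis by (simp add: gap_def algebra_simps)
qed

text \<open>Right piece of the minorant in cases 2 and 3. On [c, b] this is convexity; on [m, c] it
  suffices to compare at m, where the gap is nonpositive, and at c.\<close>

lemma line_below:
  assumes x: "c \<le> x" "x \<le> b" "gap x \<le> 0" and y: "m \<le> y" "y \<le> b"
  shows "f x + g x * (y - x) \<le> f y"
proof (cases "y \<le> c")
  case True
  have "(f x - g x * x) + g x * y \<le> f y"
    using above_chord[of m y c "f x - g x * x" "g x"] above_tangent[of x c] x y order True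
    by (simp add: gap_def algebra_simps)
  then show ?thesis by (simp add: algebra_simps)
next
  case False
  then show ?thesis using above_tangent x y by auto
qed

text \<open>Right piece in case 1. A nonnegative gap at b makes the chord at least as steep as the
  tangent at b, so on [c, b] the chord runs below that tangent and hence below f; concavity handles
  [m, c].\<close>

lemma above_chord_right:
  assumes b: "gap b \<ge> 0" and y: "m \<le> y" "y \<le> b"
  shows "f m + (f b - f m) / (b - m) * (y - m) \<le> f y"
proof -
  define s where "s = (f b - f m) / (b - m)"
  have s: "f b = f m + s * (b - m)" using order by (simp add: s_def)
  have "s * (b - m) \<ge> g b * (b - m)" using b s by (simp add: gap_def algebra_simps)
  then have "s \<ge> g b" using order by (simp add: mult_le_cancel_right)
  have *: "f m + s * (z - m) \<le> f z" if "c \<le> z" "z \<le> b" for z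
  proof -
    have "g b * (b - z) \<le> s * (b - z)" using \<open>s \<ge> g b\<close> that by (intro mult_right_mono) auto
    with above_tangent[of b z] s that order show ?thesis by (simp add: algebra_simps)
  qed
  show ?thesis unfolding s_def[symmetric]
  proof (cases "y \<le> c")
    case True
    have "(f m - s * m) + s * y \<le> f y"
      using above_chord[of m y c "f m - s * m" s] *[of c] y order True
      by (simp add: algebra_simps)
    then show "f m + s * (y - m) \<le> f y" by (simp add: algebra_simps)
  qed (use * y in auto)
qed

text \<open>The height v at m may be below \<open>f m\<close>, as case 3 requires.\<close>

lemma above_chord_left:
  assumes "v \<le> f m" "a \<le> y" "y \<le> m"
  shows "v + (v - f a) / (m - a) * (y - m) \<le> f y"
proof -
  define s where "s = (v - f a) / (m - a)"
  have s: "v = f a + s * (m - a)" using order by (simp add: s_def)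
  have "(v - s * m) + s * y \<le> f y"
    using above_chord[of a y m "v - s * m" s] s assms order
    by (simp add: algebra_simps)
  then show ?thesis unfolding s_def[symmetric] by (simp add: algebra_simps)
qed

text \<open>The gap is positive on (m, c] and strictly decreasing on [c, b], so it has exactly one
  zero. This justifies the definite description in \<open>tangent_point\<close>.\<close>

lemma tangent_exists:
  assumes "gap b < 0"
  obtains x where "c < x" "x < b" "gap x = 0" "\<And>y. m < y \<Longrightarrow> y \<le> b \<Longrightarrow> gap y = 0 \<Longrightarrow> y = x"
proof -
  have "continuous_on {a..b} f"
    by (rule DERIV_continuous_on) (auto intro: has_field_derivative_at_within der)
  then have "continuous_on {a..b} gap"
    unfolding gap_def [abs_def] by (intro continuous_intros cont_g)
  then have "continuous_on {c..b} gap" by (rule continuous_on_subset) (use order in auto)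
  moreover have "gap c > 0" using gap_pos order by auto
  ultimately obtain x where x: "c \<le> x" "x \<le> b" "gap x = 0"
    using IVT2'[of gap b 0 c] assms order by auto
  have "y = x" if "m < y" "y \<le> b" "gap y = 0" for y
  proof -
    have "y > c" using gap_pos[of y] that by force
    then show ?thesis using gap_dec[of x y] gap_dec[of y x] x that by (metis less_irrefl less_imp_le linorder_neqE_linordered_idom)
  qed
  moreover have "x \<noteq> b" "x \<noteq> c" using x assms \<open>gap c > 0\<close> by auto
  ultimately show thesis using that[of x] x by auto
qed

end

section \<open>The ambiguity set\<close>

text \<open>A two-piece linear function with its kink at m is a combination of 1, x - m and |x - m|,
  so the moment constraints alone determine its expectation.\<close>

lemma mad_ambiguity_set_lower:
  assumes P: "P \<in> mad_ambiguity_set a b m d" and f: "continuous_on {a..b} f"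
    and left: "\<And>y. a \<le> y \<Longrightarrow> y \<le> m \<Longrightarrow> v + s * (y - m) \<le> f y"
    and right: "\<And>y. m \<le> y \<Longrightarrow> y \<le> b \<Longrightarrow> v + t * (y - m) \<le> f y"
  shows "v + (t - s) * d / 2 \<le> (\<integral>x. f x \<partial>P)"
proof -
  interpret prob_space P using P by (simp add: mad_ambiguity_set_def)
  have sets: "sets P = sets (restrict_space borel {a..b})"
    and mean: "(\<integral>x. x \<partial>P) = m" and mad: "(\<integral>x. \<bar>x - m\<bar> \<partial>P) = d"
    using P by (auto simp: mad_ambiguity_set_def)
  have space: "space P = {a..b}"
    using sets_eq_imp_space_eq[OF sets] by (simp add: space_restrict_space)
  have int: "integrable P h" if h: "continuous_on {a..b} h" for h :: "real \<Rightarrow> real"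
  proof -
    have "compact (h ` {a..b})" using h by (rule compact_continuous_image) simp
    then obtain B where "\<And>x. x \<in> {a..b} \<Longrightarrow> norm (h x) \<le> B"
      by (metis bounded_iff compact_imp_bounded imageI)
    moreover have "h \<in> borel_measurable P"
      using borel_measurable_continuous_on_restrict[OF h] measurable_cong_sets[OF sets refl] by blast
    ultimately show ?thesis
      by (intro integrable_const_bound[where B = B]) (auto simp: space)
  qed
  have "(\<integral>x. v + (s + t) / 2 * (x - m) + (t - s) / 2 * \<bar>x - m\<bar> \<partial>P) \<le> (\<integral>x. f x \<partial>P)"
  proof (rule integral_mono)
    show "v + (s + t) / 2 * (x - m) + (t - s) / 2 * \<bar>x - m\<bar> \<le> f x" if "x \<in> space P" for x
    proof (cases "x \<le> m")
      case True
      then have "v + (s + t) / 2 * (x - m) + (t - s) / 2 * \<bar>x - m\<bar> = v + s * (x - m)"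
        by (simp add: field_simps)
      then show ?thesis using left[of x] True that by (simp add: space)
    next
      case False
      then have "v + (s + t) / 2 * (x - m) + (t - s) / 2 * \<bar>x - m\<bar> = v + t * (x - m)"
        by (simp add: field_simps)
      then show ?thesis using right[of x] False that by (simp add: space)
    qed
  qed (intro int continuous_intros f)+
  moreover have "integrable P (\<lambda>x. x)" "integrable P (\<lambda>x. \<bar>x - m\<bar>)"
    by (intro int continuous_intros)+
  then have "(\<integral>x. v + (s + t) / 2 * (x - m) + (t - s) / 2 * \<bar>x - m\<bar> \<partial>P)
      = v + (s + t) / 2 * (m - m) + (t - s) / 2 * d"
    by (simp add: mean mad prob_space)
  ultimately show ?thesis by simp
qed

text \<open>Each side of m must carry half of the deviation, p (m - a) = q (x - m) = d / 2, which
  forces the weights at a and x; the remaining mass sits at m.\<close>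

lemma mad_ambiguity_set_three_point:
  assumes "a < m" "m < x" "x \<le> b" "0 < d"
    and "d / (2 * (m - a)) + d / (2 * (x - m)) \<le> 1"
  obtains P where "P \<in> mad_ambiguity_set a b m d"
    "\<And>f. continuous_on {a..b} f \<Longrightarrow> (\<integral>y. f y \<partial>P)
       = d / (2 * (m - a)) * f a + (1 - d / (2 * (m - a)) - d / (2 * (x - m))) * f m
         + d / (2 * (x - m)) * f x"
proof -
  define p where "p = d / (2 * (m - a))"
  define q where "q = d / (2 * (x - m))"
  have half: "d / (2 * k) * k = d / 2" if "k \<noteq> 0" for k using that by simp
  have p: "p \<ge> 0" "p * (m - a) = d / 2" and q: "q \<ge> 0" "q * (x - m) = d / 2" and pq: "p + q \<le> 1"
    using assms half[of "m - a"] half[of "x - m"] by (simp_all add: p_def q_def)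
  define w where "w = (\<lambda>y. if y = a then p else if y = x then q else 1 - p - q)"
  define M where "M = point_measure {a, m, x} (\<lambda>y. ennreal (w y))"
  \<comment> \<open>Transports the finite measure to the Borel sets of [a, b].\<close>
  define P where "P = distr M (restrict_space borel {a..b}) (\<lambda>y. y)"
  have w: "w y \<ge> 0" for y using p q pq by (simp add: w_def)
  have "emeasure M (space M) = (\<Sum>y\<in>{a, m, x}. ennreal (w y))"
    by (simp add: M_def space_point_measure emeasure_point_measure_finite)
  also have "\<dots> = ennreal (\<Sum>y\<in>{a, m, x}. w y)"
    using w by (intro sum_ennreal) auto
  also have "(\<Sum>y\<in>{a, m, x}. w y) = 1" using assms by (simp add: w_def)
  finally interpret M: prob_space M by (intro prob_spaceI) simp
  have meas: "(\<lambda>y. y) \<in> measurable M (restrict_space borel {a..b})"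
    using assms by (auto simp: M_def space_restrict_space)
  have int: "(\<integral>y. f y \<partial>P) = p * f a + (1 - p - q) * f m + q * f x"
    if f: "continuous_on {a..b} f" for f :: "real \<Rightarrow> real"
  proof -
    have "(\<integral>y. f y \<partial>P) = (\<integral>y. f y \<partial>M)"
      unfolding P_def
      by (rule integral_distr[OF meas borel_measurable_continuous_on_restrict[OF f]])
    also have "\<dots> = (\<Sum>y\<in>{a, m, x}. w y *\<^sub>R f y)"
      unfolding M_def by (rule lebesgue_integral_point_measure_finite) (use w in auto)
    also have "\<dots> = p * f a + (1 - p - q) * f m + q * f x"
      using assms by (simp add: w_def)
    finally show ?thesis .
  qed
  have "prob_space P" unfolding P_def by (rule M.prob_space_distr[OF meas])
  moreover have "(\<integral>y. y \<partial>P) = m"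
  proof -
    have "(\<integral>y. y \<partial>P) = m - p * (m - a) + q * (x - m)"
      by (subst int) (auto intro: continuous_intros simp: algebra_simps)
    then show ?thesis by (simp add: p q)
  qed
  moreover have "(\<integral>y. \<bar>y - m\<bar> \<partial>P) = d"
  proof -
    have "(\<integral>y. \<bar>y - m\<bar> \<partial>P) = p * (m - a) + q * (x - m)"
      using assms by (subst int) (auto intro!: continuous_intros simp: algebra_simps)
    then show ?thesis by (simp add: p q)
  qed
  ultimately have "P \<in> mad_ambiguity_set a b m d"
    by (simp add: mad_ambiguity_set_def P_def)
  then show thesis using that int unfolding p_def q_def by blast
qed

text \<open>Dual certificate: the minorant meets f at a and x, and also at m unless m has no mass,
  as the condition on \<open>v\<close> says. The three-point measure thus attains the lower
  bound.\<close>

lemma worst_case_benefit_eq: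
  fixes R C \<mu> a b m d x v t :: real and n :: nat
  defines "f \<equiv> benefit_rate R C \<mu> n"
  assumes ord: "a < m" "m < x" "x \<le> b" "0 < d" and cont: "continuous_on {a..b} f"
    and le: "d / (2 * (m - a)) + d / (2 * (x - m)) \<le> 1"
    and v: "v = f m \<or> d / (2 * (m - a)) + d / (2 * (x - m)) = 1"
    and left: "\<And>y. a \<le> y \<Longrightarrow> y \<le> m \<Longrightarrow> v + (v - f a) / (m - a) * (y - m) \<le> f y"
    and right: "\<And>y. m \<le> y \<Longrightarrow> y \<le> b \<Longrightarrow> v + t * (y - m) \<le> f y"
    and touch: "v + t * (x - m) = f x"
  shows "worst_case_benefit R C \<mu> a b m d n
    = d / (2 * (m - a)) * f a + (1 - d / (2 * (m - a)) - d / (2 * (x - m))) * f m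
      + d / (2 * (x - m)) * f x"
proof -
  define p where "p = d / (2 * (m - a))"
  define q where "q = d / (2 * (x - m))"
  define s where "s = (v - f a) / (m - a)"
  have s: "f a = v - s * (m - a)" using ord by (simp add: s_def)
  have half: "d / (2 * k) * k = d / 2" if "k \<noteq> 0" for k using that by simp
  have p: "p * (m - a) = d / 2" and q: "q * (x - m) = d / 2"
    using ord half[of "m - a"] half[of "x - m"] by (simp_all add: p_def q_def)
  have "(1 - p - q) * f m = (1 - p - q) * v" using v by (auto simp: p_def q_def)
  then have "p * f a + (1 - p - q) * f m + q * f x
      = v - s * (p * (m - a)) + t * (q * (x - m))"
    by (simp add: s touch[symmetric] algebra_simps)
  then have val: "v + (t - s) * d / 2 = p * f a + (1 - p - q) * f m + q * f x"
    unfolding p q by (simp add: algebra_simps diff_divide_distrib)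
  obtain P where P: "P \<in> mad_ambiguity_set a b m d"
    "(\<integral>y. f y \<partial>P) = p * f a + (1 - p - q) * f m + q * f x"
    using mad_ambiguity_set_three_point[OF ord le] cont unfolding p_def q_def by metis
  have low: "p * f a + (1 - p - q) * f m + q * f x \<le> (\<integral>y. f y \<partial>Q)"
    if "Q \<in> mad_ambiguity_set a b m d" for Q
    unfolding val[symmetric]
    by (rule mad_ambiguity_set_lower[OF that cont left[folded s_def] right])
  have "(INF Q \<in> mad_ambiguity_set a b m d. \<integral>y. f y \<partial>Q) = p * f a + (1 - p - q) * f m + q * f x"
    using P low by (intro cInf_eq_minimum) (auto intro: rev_image_eqI)
  then show ?thesis unfolding worst_case_benefit_def f_def[symmetric] p_def q_def .
qed

section \<open>Choice of atom and minorant in the three cases\<close>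

theorem theorem3p4:
  fixes R C \<mu> a b m d :: real and n :: nat
  defines "f \<equiv> benefit_rate R C \<mu> n"
  defines "\<rho>\<^sub>t \<equiv> tangent_point f m b"
  defines "d\<^sub>0 \<equiv> 2 * (m - a) * (\<rho>\<^sub>t - m) / (\<rho>\<^sub>t - a)"
  assumes "R > 0" and "C > 0" and "\<mu> > 0"
    and "0 \<le> a" and "a < b" and "a < m" and "m < b"
    and "0 < d" and "d < 2 * (m - a) * (b - m) / (b - a)"
    and "n \<ge> 1" and "m \<in> {0..1}" and "R * \<mu> / C \<ge> real n + 1"
  shows
    "(f b + deriv f b * (m - b) \<ge> f m \<longrightarrow>
        worst_case_benefit R C \<mu> a b m d n =
          d / (2 * (m - a)) * f a
          + (1 - d / (2 * (m - a)) - d / (2 * (b - m))) * f m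
          + d / (2 * (b - m)) * f b) \<and>
     (f b + deriv f b * (m - b) < f m \<and> d < d\<^sub>0 \<longrightarrow>
        worst_case_benefit R C \<mu> a b m d n =
          d / (2 * (m - a)) * f a
          + (1 - d / (2 * (m - a)) - d / (2 * (\<rho>\<^sub>t - m))) * f m
          + d / (2 * (\<rho>\<^sub>t - m)) * f \<rho>\<^sub>t) \<and>
     (f b + deriv f b * (m - b) < f m \<and> d \<ge> d\<^sub>0 \<longrightarrow>
        worst_case_benefit R C \<mu> a b m d n =
          d / (2 * (m - a)) * f a
          + (1 - d / (2 * (m - a)))
              * f ((a * d + 2 * m * (a - m)) / (d + 2 * (a - m))))"
proof -
  note ord = \<open>0 \<le> a\<close> \<open>a < m\<close> \<open>m < b\<close> \<open>0 < d\<close>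
  define g where "g = benefit_slope R C \<mu> n"
  obtain c where c: "m < c" "c \<le> b" "strict_antimono_on {0..c} g" "strict_mono_on {c..b} g"
    using benefit_slope_monotonicity[of C n R \<mu> m b] assms unfolding g_def by auto
  have rate_der: "(f has_real_derivative g x) (at x)" if "x \<ge> 0" for x
    using that unfolding f_def g_def by (intro benefit_rate_derivative) auto
  interpret concave_convex f g a m b c
  proof
    show "strict_antimono_on {a..c} g" using c(3) ord by (auto simp: monotone_on_def)
    show "continuous_on {a..b} g" unfolding g_def
      by (rule continuous_on_subset[OF continuous_on_benefit_slope]) (use ord in auto)
  qed (use c ord rate_der in auto)
  have cont: "continuous_on {a..b} f"
    by (rule DERIV_continuous_on) (use ord in \<open>auto intro: has_field_derivative_at_within der\<close>)
  have deriv: "deriv f x = g x" if "x \<ge> 0" for x using rate_der that by (intro DERIV_imp_deriv)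
  \<comment> \<open>Nonnegativity of the mass left at m: for x = b this is the bound on d, and for
    the tangent point it is \<open>d \<le> d\<^sub>0\<close>.\<close>
  have weights: "d / (2 * (m - a)) + d / (2 * (x - m)) \<le> 1
      \<longleftrightarrow> d \<le> 2 * (m - a) * (x - m) / (x - a)" if "m < x" for x
  proof -
    have "d / (2 * A) + d / (2 * B) \<le> 1 \<longleftrightarrow> d \<le> 2 * A * B / (A + B)" if "A > 0" "B > 0" for A B
    proof -
      have "d / (2 * A) + d / (2 * B) = d * (A + B) / (2 * A * B)"
        using that by (simp add: field_simps)
      then show ?thesis using that by (simp add: pos_le_divide_eq pos_divide_le_eq)
    qed
    from this[of "m - a" "x - m"] show ?thesis using that ord by simp
  qed
  have gap_b: "f b + deriv f b * (m - b) = gap b + f m"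
    using deriv[of b] ord by (simp add: gap_def)
  have left: "f m + (f m - f a) / (m - a) * (y - m) \<le> f y" if "a \<le> y" "y \<le> m" for y
    using above_chord_left[of "f m" y] that by simp
  show ?thesis
  proof (intro conjI impI; (elim conjE)?)
    assume "f b + deriv f b * (m - b) \<ge> f m"
    then have "gap b \<ge> 0" by (simp add: gap_b)
    then have right: "f m + (f b - f m) / (b - m) * (y - m) \<le> f y" if "m \<le> y" "y \<le> b" for y
      using above_chord_right that by simp
    show "worst_case_benefit R C \<mu> a b m d n = d / (2 * (m - a)) * f a
          + (1 - d / (2 * (m - a)) - d / (2 * (b - m))) * f m + d / (2 * (b - m)) * f b"
      unfolding f_def
    proof (rule worst_case_benefit_eq, fold f_def)
      show "d / (2 * (m - a)) + d / (2 * (b - m)) \<le> 1"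
        using weights[of b] assms by simp
      show "f m + (f m - f a) / (m - a) * (y - m) \<le> f y" if "a \<le> y" "y \<le> m" for y
        using left that .
      show "f m + (f b - f m) / (b - m) * (y - m) \<le> f y" if "m \<le> y" "y \<le> b" for y
        using right that .
    qed (use ord cont in auto)
  next
    assume "f b + deriv f b * (m - b) < f m"
    then have "gap b < 0" by (simp add: gap_b)
    then obtain z where z: "c < z" "z < b" "gap z = 0"
      "\<And>y. m < y \<Longrightarrow> y \<le> b \<Longrightarrow> gap y = 0 \<Longrightarrow> y = z"
      using tangent_exists by blast
    have tang: "y \<in> {m<..b} \<and> f y + deriv f y * (m - y) = f m \<longleftrightarrow> m < y \<and> y \<le> b \<and> gap y = 0" for y
      using deriv[of y] ord by (auto simp: gap_def)
    have t: "\<rho>\<^sub>t = z"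
      unfolding \<rho>\<^sub>t_def tangent_point_def tang using z c by (intro the_equality) auto
    {
      assume "d < d\<^sub>0"
      show "worst_case_benefit R C \<mu> a b m d n = d / (2 * (m - a)) * f a
          + (1 - d / (2 * (m - a)) - d / (2 * (\<rho>\<^sub>t - m))) * f m + d / (2 * (\<rho>\<^sub>t - m)) * f \<rho>\<^sub>t"
        unfolding f_def t
      proof (rule worst_case_benefit_eq, fold f_def)
        show "d / (2 * (m - a)) + d / (2 * (z - m)) \<le> 1"
          using weights[of z] \<open>d < d\<^sub>0\<close> z c unfolding d\<^sub>0_def t by simp
        show "f m + (f m - f a) / (m - a) * (y - m) \<le> f y" if "a \<le> y" "y \<le> m" for y
          using left that .
        \<comment> \<open>As the gap vanishes at z, this line is the tangent at z.\<close>
        show "f m + g z * (y - m) \<le> f y" if "m \<le> y" "y \<le> b" for y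
          using line_below[of z y] z that by (simp add: gap_def algebra_simps)
        show "f m + g z * (z - m) = f z" using z by (simp add: gap_def algebra_simps)
      qed (use ord cont z c in auto)
    next
      assume "d \<ge> d\<^sub>0"
      \<comment> \<open>The solution of d / (2 (m - a)) + d / (2 (x - m)) = 1, which leaves no mass
        at m.\<close>
      define x where "x = (a * d + 2 * m * (a - m)) / (d + 2 * (a - m))"
      \<comment> \<open>The value at m of the tangent at x, now the height of the kink.\<close>
      define v where "v = f x + g x * (m - x)"
      have "d < 2 * (m - a) * (b - m) / (b - a)" by fact
      also have "\<dots> \<le> 2 * (m - a)"
        using ord by (simp add: pos_divide_le_eq mult_left_mono)
      finally have d: "2 * (m - a) - d > 0" by simp
      have "d + 2 * (a - m) \<noteq> 0" using d by simp
      then have xm: "x - m = d * (m - a) / (2 * (m - a) - d)"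
        using d by (simp add: x_def field_simps)
      have "m < x" using xm ord d by (metis diff_gt_0_iff_gt divide_pos_pos mult_pos_pos)
      \<comment> \<open>The condition \<open>d \<ge> d\<^sub>0\<close> puts x at or beyond the
        tangent point, where the gap is nonpositive and hence v is at most
        \<open>f m\<close>.\<close>
      have ge: "z \<le> x"
      proof -
        have "2 * (m - a) * (z - m) \<le> d * (z - a)"
          using \<open>d \<ge> d\<^sub>0\<close> ord z c unfolding d\<^sub>0_def t by (simp add: pos_divide_le_eq)
        then have "(z - m) * (2 * (m - a) - d) \<le> d * (m - a)" by (simp add: algebra_simps)
        then have "z - m \<le> x - m" unfolding xm using d by (simp add: pos_le_divide_eq)
        then show ?thesis by simp
      qed
      have le: "x \<le> b"
      proof -
        have "d * (b - a) \<le> 2 * (m - a) * (b - m)"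
          using \<open>d < 2 * (m - a) * (b - m) / (b - a)\<close> ord by (simp add: pos_less_divide_eq)
        then have "d * (m - a) \<le> (b - m) * (2 * (m - a) - d)" by (simp add: algebra_simps)
        then have "x - m \<le> b - m" unfolding xm using d by (simp add: pos_divide_le_eq)
        then show ?thesis by simp
      qed
      have sum: "d / (2 * (m - a)) + d / (2 * (x - m)) = 1"
      proof -
        have "d / (2 * A) + d / (2 * (d * A / e)) = (d + e) / (2 * A)" if "A > 0" "e > 0" for A e
          using that ord by (simp add: field_simps)
        from this[of "m - a" "2 * (m - a) - d"] show ?thesis unfolding xm using ord d by simp
      qed
      have gap: "gap x \<le> 0" using gap_dec[of z x] z ge le by (cases "z = x") auto
      then have v: "v \<le> f m" by (simp add: v_def gap_def)
      have "worst_case_benefit R C \<mu> a b m d n = d / (2 * (m - a)) * f a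
          + (1 - d / (2 * (m - a)) - d / (2 * (x - m))) * f m + d / (2 * (x - m)) * f x"
        unfolding f_def
      proof (rule worst_case_benefit_eq, fold f_def)
        show "v + (v - f a) / (m - a) * (y - m) \<le> f y" if "a \<le> y" "y \<le> m" for y
          using above_chord_left[OF v that] .
        show "v + g x * (y - m) \<le> f y" if "m \<le> y" "y \<le> b" for y
          using line_below[of x y] gap z ge le that by (simp add: v_def algebra_simps)
        show "v + g x * (x - m) = f x" by (simp add: v_def algebra_simps)
      qed (use ord cont \<open>m < x\<close> le sum in auto)
      also have "\<dots> = d / (2 * (m - a)) * f a + (1 - d / (2 * (m - a))) * f x"
      proof -
        have "d / (2 * (x - m)) = 1 - d / (2 * (m - a))" using sum by simp
        then show ?thesis by (simp only:) simp
      qed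
      finally show "worst_case_benefit R C \<mu> a b m d n = d / (2 * (m - a)) * f a
          + (1 - d / (2 * (m - a))) * f ((a * d + 2 * m * (a - m)) / (d + 2 * (a - m)))"
        unfolding x_def .
    }
  qed
qed

end
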